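(* Let $0<\eta<1$ be a fixed number. For every $M<\infty$ there is a constant $C<\infty$, depending only on $M$ (for the fixed $\eta$), such that the following holds. Let $\mu$ be a positive measure on $\mathbb{R}^d$ and let $\mathcal{E}$ be a collection of measurable sets of finite $\mu$-measure such that $$\mu\bigl(\bigl\{x:\ \mathcal{M}_{\mathcal{E}}^{\mu}(\mathbbm{1}_E)(x)>\eta\bigr\}\bigr)\le M\,\mu(E)\qquad\text{for all measurable sets }E .$$ Then $\mathcal{E}$ can be partitioned into at most $C\max\bigl(1,\|\mathcal{E}\|_{\mathrm{Carleson}(\mu)}\bigr)$ subcollections $\{\mathcal{E}_i\}$ satisfying $$\|\mathcal{E}_i\|_{\mathrm{Carleson}(\mu)}\le C\qquad\text{for every } i.$$
   Context: A collection (or family) is a finite unordered sequence of sets; repeated elements are allowed, and sums over a collection count multiplicity. For a collection $\mathcal{F}$, its shadow is $\mathrm{sh}(\mathcal{F})=\bigcup_{R\in\mathcal{F}}R$. The convention $\frac00=0$ is used. The Carleson constant of $\mathcal{E}$ with respect to $\mu$ is $$\|\mathcal{E}\|_{\mathrm{Carleson}(\mu)}=\sup\Bigl\{\frac{1}{\mu(\mathrm{sh}(\mathcal{F}))}\sum_{R\in\mathcal{F}}\mu(R):\ \mathcal{F}\subseteq\mathcal{E}\Bigr\}.$$ The maximal operator associated to $\mathcal{E}$ and $\mu$ is $$\mathcal{M}_{\mathcal{E}}^{\mu}f(x)=\sup_{R\in\mathcal{E}}\frac{\mathbbm{1}_R(x)}{\mu(R)}\int_R|f|\,d\mu .$$ 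*)

theory Defs
  imports "HOL-Analysis.Analysis" "HOL-Library.Multiset"
begin

text \<open>
  The space \<open>\<real>\<^sup>d\<close> is given by an explicit carrier rather than by a type,
  so that a constant can be asserted to be independent of \<open>d\<close>.
\<close>

definition Rdim :: "nat \<Rightarrow> (nat \<Rightarrow> real) set" where
  "Rdim d = {..<d} \<rightarrow>\<^sub>E UNIV"

text \<open>
  Collections are finite with repetitions allowed, hence multisets of sets;
  subcollections are sub-multisets.
\<close>

definition shadow :: "'a set multiset \<Rightarrow> 'a set" where
  "shadow F = \<Union> (set_mset F)"

text \<open>
  The values below are in \<^typ>\<open>ennreal\<close>, where \<open>0 / 0 = 0\<close>, as required,
  and \<open>1 / 0 * 0 = 0\<close>, so sets of measure zero contribute
  nothing to the maximal operator.
\<close>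

definition carleson :: "'a measure \<Rightarrow> 'a set multiset \<Rightarrow> ennreal" where
  "carleson \<mu> \<E> =
     (SUP F \<in> {F. F \<subseteq># \<E>}. (\<Sum>R\<in>#F. emeasure \<mu> R) / emeasure \<mu> (shadow F))"

definition maximal_op ::
  "'a measure \<Rightarrow> 'a set multiset \<Rightarrow> ('a \<Rightarrow> real) \<Rightarrow> 'a \<Rightarrow> ennreal" where
  "maximal_op \<mu> \<E> f x =
     (SUP R \<in> set_mset \<E>.
        indicator R x / emeasure \<mu> R * (\<integral>\<^sup>+y\<in>R. ennreal \<bar>f y\<bar> \<partial>\<mu>))"

end

theory Submission
  imports Defs
begin

text \<open>
  Put \<open>h\<^sub>F = \<Sum>\<^bsub>R \<in> F\<^esub> 1\<^sub>R\<close> and let \<open>T > M \<parallel>\<E>\<parallel>\<close>. In every nonempty \<open>F \<subseteq> \<E>\<close> some \<open>R\<close>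
  satisfies \<open>\<mu>(R \<inter> {h\<^sub>F > T}) \<le> \<eta> \<mu>(R)\<close>: otherwise the maximal function of the indicator of
  \<open>{h\<^sub>F > T}\<close> exceeds \<open>\<eta>\<close> on \<open>sh(F)\<close>, so \<open>\<mu>(sh(F)) \<le> M \<mu>{h\<^sub>F > T} \<le> (M / T) \<parallel>\<E>\<parallel> \<mu>(sh(F))\<close>.
  Removing such sets one at a time and inserting them in the reverse order, distribute them
  greedily over \<open>N\<close> classes, putting \<open>R\<close> in a class whose current shadow covers at most the
  fraction \<open>\<theta> = (1 + \<eta>) / 2\<close> of \<open>R\<close>. If no class were admissible, integrating the number of
  class shadows over \<open>R\<close>, which is at most \<open>T\<close> off \<open>{h\<^sub>F > T}\<close> and at most \<open>N\<close> on it, would give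
  \<open>N \<theta> < T + N \<eta>\<close>; so \<open>N \<ge> T / (\<theta> - \<eta>)\<close> classes suffice. Each set adds to
  the shadow of its class at least \<open>1 - \<theta>\<close> of its own measure, so a class has
  Carleson constant at most \<open>1 / (1 - \<theta>)\<close>.
\<close>

section \<open>Shadows: measurability and finite measure\<close>

lemma shadow_empty [simp]: "shadow {#} = {}"
  by (simp add: shadow_def)

lemma shadow_add_mset [simp]: "shadow (add_mset R F) = R \<union> shadow F"
  by (simp add: shadow_def)

lemma shadow_mono: "F \<subseteq># G \<Longrightarrow> shadow F \<subseteq> shadow G"
  unfolding shadow_def by (meson Union_mono set_mset_mono)

lemma sets_shadow [measurable]:
  assumes "\<And>R. R \<in># F \<Longrightarrow> R \<in> sets \<mu>"
  shows "shadow F \<in> sets \<mu>"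
  unfolding shadow_def using assms by (intro sets.finite_Union) auto

lemma emeasure_shadow_finite:
  assumes "\<And>R. R \<in># F \<Longrightarrow> R \<in> sets \<mu> \<and> emeasure \<mu> R < \<infinity>"
  shows "emeasure \<mu> (shadow F) < \<infinity>"
  using assms
proof (induction F)
  case (add R F)
  have "emeasure \<mu> (R \<union> shadow F) \<le> emeasure \<mu> R + emeasure \<mu> (shadow F)"
    using add.prems by (intro emeasure_subadditive sets_shadow) auto
  also have "\<dots> < \<infinity>"
    using add by (auto simp: ennreal_add_less_top)
  finally show ?case by simp
qed simp

section \<open>The Carleson constant in division-free form\<close>

lemma sum_emeasure_le_size_shadow:
  assumes "\<And>R. R \<in># F \<Longrightarrow> R \<in> sets \<mu>"
  shows "(\<Sum>R\<in>#F. emeasure \<mu> R) \<le> of_nat (size F) * emeasure \<mu> (shadow F)"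
proof -
  have "(\<Sum>R\<in>#F. emeasure \<mu> R) \<le> (\<Sum>R\<in>#F. emeasure \<mu> (shadow F))"
    using assms by (intro sum_mset_mono emeasure_mono sets_shadow) (auto simp: shadow_def)
  then show ?thesis by simp
qed

text \<open>Multiplying out the quotient is harmless even for a null shadow: the hypothesis then
  forces the sum to vanish, and \<open>0 / 0 = 0\<close>.\<close>

lemma carleson_leI:
  assumes "\<And>F. F \<subseteq># \<E> \<Longrightarrow> (\<Sum>R\<in>#F. emeasure \<mu> R) \<le> K * emeasure \<mu> (shadow F)"
  shows "carleson \<mu> \<E> \<le> K"
  unfolding carleson_def
proof (rule SUP_least)
  fix F assume "F \<in> {F. F \<subseteq># \<E>}"
  then have le: "(\<Sum>R\<in>#F. emeasure \<mu> R) \<le> K * emeasure \<mu> (shadow F)"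
    using assms by simp
  show "(\<Sum>R\<in>#F. emeasure \<mu> R) / emeasure \<mu> (shadow F) \<le> K"
  proof (cases "emeasure \<mu> (shadow F) = 0")
    case True
    then show ?thesis using le by simp
  next
    case False
    then show ?thesis
      using le by (intro divide_le_posI_ennreal) (auto simp: mult.commute zero_less_iff_neq_zero)
  qed
qed

text \<open>Converse of \<open>carleson_leI\<close>. Cancelling the denominator needs a shadow of
  positive finite measure; over a null shadow every member is null, so both sides vanish.\<close>

lemma sum_emeasure_le_carleson:
  assumes "F \<subseteq># \<E>" and "\<And>R. R \<in># F \<Longrightarrow> R \<in> sets \<mu> \<and> emeasure \<mu> R < \<infinity>"
  shows "(\<Sum>R\<in>#F. emeasure \<mu> R) \<le> carleson \<mu> \<E> * emeasure \<mu> (shadow F)"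
proof (cases "emeasure \<mu> (shadow F) = 0")
  case True
  then show ?thesis
    using sum_emeasure_le_size_shadow[of F \<mu>] assms(2) by simp
next
  case False
  let ?S = "\<Sum>R\<in>#F. emeasure \<mu> R" and ?m = "emeasure \<mu> (shadow F)"
  have fin: "?m < \<infinity>" using emeasure_shadow_finite assms(2) by blast
  have "?S = ?S / ?m * ?m"
    using False fin by (simp add: ennreal_divide_times ennreal_mult_divide_eq less_top[symmetric])
  also have "\<dots> \<le> carleson \<mu> \<E> * ?m"
    unfolding carleson_def using assms(1) by (intro mult_right_mono SUP_upper) auto
  finally show ?thesis .
qed

text \<open>Every member of \<open>F\<close> lies in the shadow of \<open>F\<close>, so each
  quotient is at most the number of sets. Finiteness allows a real threshold \<open>T\<close> above
  \<open>M * carleson \<mu> \<E>\<close> to be chosen later.\<close>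

lemma carleson_finite:
  assumes "\<And>R. R \<in># \<E> \<Longrightarrow> R \<in> sets \<mu>"
  shows "carleson \<mu> \<E> < \<infinity>"
proof -
  have "carleson \<mu> \<E> \<le> of_nat (size \<E>)"
  proof (rule carleson_leI)
    fix F assume F: "F \<subseteq># \<E>"
    have "(\<Sum>R\<in>#F. emeasure \<mu> R) \<le> of_nat (size F) * emeasure \<mu> (shadow F)"
      using F assms by (intro sum_emeasure_le_size_shadow) (auto dest: mset_subset_eqD)
    also have "\<dots> \<le> of_nat (size \<E>) * emeasure \<mu> (shadow F)"
      using F by (intro mult_right_mono) (auto simp: size_mset_mono)
    finally show "(\<Sum>R\<in>#F. emeasure \<mu> R) \<le> of_nat (size \<E>) * emeasure \<mu> (shadow F)" .
  qed
  also have "\<dots> < \<infinity>" by (simp add: ennreal_of_nat_eq_real_of_nat)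
  finally show ?thesis .
qed

section \<open>Overlap functions\<close>

text \<open>This is the counting function \<open>h\<close> of the idea above, with multiplicity.
  Applied to \<open>image_mset shadow P\<close> it counts the class shadows containing a
  point.\<close>

definition overlap :: "'a set multiset \<Rightarrow> 'a \<Rightarrow> ennreal" where
  "overlap F x = (\<Sum>R\<in>#F. indicator R x)"

lemma overlap_empty [simp]: "overlap {#} = (\<lambda>x. 0)"
  by (simp add: overlap_def fun_eq_iff)

lemma overlap_add_mset [simp]: "overlap (add_mset R F) = (\<lambda>x. indicator R x + overlap F x)"
  by (simp add: overlap_def fun_eq_iff)

lemma borel_measurable_overlap:
  assumes "\<And>R. R \<in># F \<Longrightarrow> R \<in> sets \<mu>"
  shows "overlap F \<in> borel_measurable \<mu>"
  using assms by (induction F) auto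

lemma nn_integral_overlap:
  assumes "\<And>R. R \<in># F \<Longrightarrow> R \<in> sets \<mu>"
  shows "(\<integral>\<^sup>+x. overlap F x \<partial>\<mu>) = (\<Sum>R\<in>#F. emeasure \<mu> R)"
  using assms
  by (induction F) (auto simp: nn_integral_add borel_measurable_overlap)

lemma set_nn_integral_overlap:
  assumes "A \<in> sets \<mu>" "\<And>R. R \<in># F \<Longrightarrow> R \<in> sets \<mu>"
  shows "(\<integral>\<^sup>+x\<in>A. overlap F x \<partial>\<mu>) = (\<Sum>R\<in>#F. emeasure \<mu> (A \<inter> R))"
  using assms(2)
proof (induction F)
  case (add R F)
  have "(\<integral>\<^sup>+x\<in>A. overlap (add_mset R F) x \<partial>\<mu>)
      = (\<integral>\<^sup>+x. indicator (A \<inter> R) x + overlap F x * indicator A x \<partial>\<mu>)"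
    by (intro nn_integral_cong) (auto simp: indicator_def)
  also have "\<dots> = emeasure \<mu> (A \<inter> R) + (\<integral>\<^sup>+x\<in>A. overlap F x \<partial>\<mu>)"
    using add.prems assms(1) borel_measurable_overlap[of F \<mu>]
    by (subst nn_integral_add) auto
  finally show ?case using add by simp
qed simp

lemma overlap_eq_0: "x \<notin> shadow F \<Longrightarrow> overlap F x = 0"
  by (induction F) auto

lemma overlap_union: "overlap (F + G) x = overlap F x + overlap G x"
  by (simp add: overlap_def)

lemma indicator_shadow_le_overlap: "indicator (shadow F) x \<le> overlap F x"
proof (induction F)
  case (add R F)
  then show ?case by (auto simp: indicator_def split: if_splits)
qed simp

text \<open>A class whose shadow contains \<open>x\<close> is counted once on the left, and at least
  once on the right through its members.\<close>

lemma overlap_shadows_le: "overlap (image_mset shadow P) x \<le> overlap (\<Sum>\<^sub># P) x"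
proof (induction P)
  case (add Q P)
  then show ?case
    by (auto simp: overlap_union intro: add_mono indicator_shadow_le_overlap)
qed simp

lemma overlap_le_size: "overlap F x \<le> of_nat (size F)"
  by (induction F) (auto simp: indicator_def intro: add_mono order_trans)

section \<open>The maximal operator on indicators\<close>

lemma maximal_op_indicator:
  assumes "\<And>R. R \<in># \<E> \<Longrightarrow> R \<in> sets \<mu>" "E \<in> sets \<mu>"
  shows "maximal_op \<mu> \<E> (indicator E) x
    = (SUP R\<in>set_mset \<E>. indicator R x / emeasure \<mu> R * emeasure \<mu> (E \<inter> R))"
  unfolding maximal_op_def
proof (intro SUP_cong refl)
  fix R assume R: "R \<in># \<E>"
  have "(\<integral>\<^sup>+y\<in>R. ennreal \<bar>indicator E y\<bar> \<partial>\<mu>) = (\<integral>\<^sup>+y. indicator (E \<inter> R) y \<partial>\<mu>)"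
    by (intro nn_integral_cong) (auto simp: indicator_def)
  also have "\<dots> = emeasure \<mu> (E \<inter> R)"
    using R assms by (intro nn_integral_indicator) auto
  finally show "indicator R x / emeasure \<mu> R * (\<integral>\<^sup>+y\<in>R. ennreal \<bar>indicator E y\<bar> \<partial>\<mu>)
      = indicator R x / emeasure \<mu> R * emeasure \<mu> (E \<inter> R)" by simp
qed

text \<open>Each point of the shadow lies in some \<open>R\<close> of \<open>F\<close>, and the
  average of the indicator of \<open>E\<close> over that \<open>R\<close> already exceeds
  \<eta>.\<close>

lemma emeasure_shadow_le_maximal_op:
  assumes sets: "\<And>R. R \<in># \<E> \<Longrightarrow> R \<in> sets \<mu> \<and> emeasure \<mu> R < \<infinity>"
    and E: "E \<in> sets \<mu>" and sub: "F \<subseteq># \<E>"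
    and dense: "\<And>R. R \<in># F \<Longrightarrow> ennreal \<eta> * emeasure \<mu> R < emeasure \<mu> (E \<inter> R)"
  shows "emeasure \<mu> (shadow F)
    \<le> emeasure \<mu> {x \<in> space \<mu>. maximal_op \<mu> \<E> (indicator E) x > ennreal \<eta>}"
proof (rule emeasure_mono)
  note eq = maximal_op_indicator[of \<E> \<mu> E, OF _ E]
  \<comment> \<open>Monotonicity of \<open>emeasure\<close> requires the superlevel set to be
    measurable, since non-measurable sets get measure 0 by default. Here the supremum is over
    finitely many multiples of indicators.\<close>
  have "(\<lambda>x. SUP R\<in>set_mset \<E>. indicator R x / emeasure \<mu> R * emeasure \<mu> (E \<inter> R))
      \<in> borel_measurable \<mu>"
  proof (rule borel_measurable_SUP)
    fix R assume "R \<in> set_mset \<E>"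
    then have [measurable]: "R \<in> sets \<mu>" using sets by blast
    show "(\<lambda>x. indicator R x / emeasure \<mu> R * emeasure \<mu> (E \<inter> R)) \<in> borel_measurable \<mu>"
      by measurable
  qed (simp add: countable_finite)
  also have "(\<lambda>x. SUP R\<in>set_mset \<E>. indicator R x / emeasure \<mu> R * emeasure \<mu> (E \<inter> R))
      = maximal_op \<mu> \<E> (indicator E)"
    using sets by (intro ext eq[symmetric]) auto
  finally have [measurable]: "maximal_op \<mu> \<E> (indicator E) \<in> borel_measurable \<mu>" .
  show "{x \<in> space \<mu>. maximal_op \<mu> \<E> (indicator E) x > ennreal \<eta>} \<in> sets \<mu>"
    by measurable
  show "shadow F \<subseteq> {x \<in> space \<mu>. maximal_op \<mu> \<E> (indicator E) x > ennreal \<eta>}"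
  proof
    fix x assume "x \<in> shadow F"
    then obtain R where R: "R \<in># F" "x \<in> R" by (auto simp: shadow_def)
    have RE: "R \<in># \<E>" using R sub by (auto dest: mset_subset_eqD)
    have fin: "emeasure \<mu> R < \<infinity>" and Rm: "R \<in> sets \<mu>" using sets RE by auto
    \<comment> \<open>The strict inequality in \<open>dense\<close> excludes null sets, so the
      average over \<open>R\<close> is a genuine quotient.\<close>
    have "emeasure \<mu> R \<noteq> 0"
    proof
      assume 0: "emeasure \<mu> R = 0"
      have "emeasure \<mu> (E \<inter> R) \<le> emeasure \<mu> R" using Rm by (intro emeasure_mono) auto
      with 0 dense[OF R(1)] show False by simp
    qed
    then have "ennreal \<eta> = ennreal \<eta> * emeasure \<mu> R / emeasure \<mu> R"
      using fin by (simp add: ennreal_mult_divide_eq)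
    also have "\<dots> < emeasure \<mu> (E \<inter> R) / emeasure \<mu> R"
      unfolding divide_ennreal_def using dense[OF R(1)] \<open>emeasure \<mu> R \<noteq> 0\<close> fin
      by (intro ennreal_mult_strict_right_mono)
        (auto simp: ennreal_inverse_positive less_top[symmetric])
    also have "\<dots> = indicator R x / emeasure \<mu> R * emeasure \<mu> (E \<inter> R)"
      using R by (simp add: ennreal_divide_times)
    also have "\<dots> \<le> maximal_op \<mu> \<E> (indicator E) x"
      using sets by (subst eq) (auto intro: SUP_upper RE)
    finally show "x \<in> {x \<in> space \<mu>. maximal_op \<mu> \<E> (indicator E) x > ennreal \<eta>}"
      using R Rm sets.sets_into_space by auto
  qed
qed

section \<open>Selecting a set to remove and a class to receive it\<close>

lemma exists_set_of_small_overlap: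
  assumes sets: "\<And>R. R \<in># \<E> \<Longrightarrow> R \<in> sets \<mu> \<and> emeasure \<mu> R < \<infinity>"
    and weak: "\<And>E. E \<in> sets \<mu> \<Longrightarrow>
      emeasure \<mu> {x \<in> space \<mu>. maximal_op \<mu> \<E> (indicator E) x > ennreal \<eta>} \<le> M * emeasure \<mu> E"
    and sub: "F \<subseteq># \<E>" and ne: "F \<noteq> {#}" and T: "M * carleson \<mu> \<E> < T"
  shows "\<exists>R\<in>#F. emeasure \<mu> ({x \<in> space \<mu>. T < overlap F x} \<inter> R) \<le> ennreal \<eta> * emeasure \<mu> R"
proof (rule ccontr)
  define B where "B = {x \<in> space \<mu>. T < overlap F x}"
  have setsF: "R \<in> sets \<mu> \<and> emeasure \<mu> R < \<infinity>" if "R \<in># F" for R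
    using sets mset_subset_eqD[OF sub that] .
  assume "\<not> ?thesis"
  then have dense: "ennreal \<eta> * emeasure \<mu> R < emeasure \<mu> (B \<inter> R)" if "R \<in># F" for R
    using that by (simp add: not_le B_def)
  have m: "overlap F \<in> borel_measurable \<mu>"
    using setsF by (intro borel_measurable_overlap) auto
  have B: "B \<in> sets \<mu>" unfolding B_def using m by measurable
  have shadow_le: "emeasure \<mu> (shadow F) \<le> M * emeasure \<mu> B"
    using emeasure_shadow_le_maximal_op[OF sets B sub dense] weak[OF B] by (rule order_trans)
  \<comment> \<open>This makes the measure of \<open>B\<close> finite, and \<open>dense\<close>
    makes it positive; both are needed for the strict multiplication that ends the proof.\<close>
  have "B \<subseteq> shadow F"
  proof
    fix x assume "x \<in> B"
    then have "overlap F x \<noteq> 0" by (auto simp: B_def)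
    then show "x \<in> shadow F" using overlap_eq_0 by metis
  qed
  then have "emeasure \<mu> B \<le> emeasure \<mu> (shadow F)"
    using setsF by (intro emeasure_mono sets_shadow) auto
  also have "\<dots> < \<infinity>" using setsF by (rule emeasure_shadow_finite)
  finally have fin: "emeasure \<mu> B < \<infinity>" .
  obtain R where R: "R \<in># F" using ne by (metis multiset_nonemptyE)
  have "emeasure \<mu> (B \<inter> R) \<le> emeasure \<mu> B" using B by (intro emeasure_mono) auto
  then have pos: "emeasure \<mu> B \<noteq> 0" using dense[OF R] by auto
  \<comment> \<open>Markov's inequality for the overlap, followed by the Carleson bound and
    \<open>shadow_le\<close>, yields
    \<open>T * emeasure \<mu> B < T * emeasure \<mu> B\<close>.\<close>
  have "T * emeasure \<mu> B = (\<integral>\<^sup>+x. T * indicator B x \<partial>\<mu>)"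
    using B by (simp add: nn_integral_cmult_indicator)
  also have "\<dots> \<le> (\<integral>\<^sup>+x. overlap F x \<partial>\<mu>)"
    by (intro nn_integral_mono) (auto simp: B_def indicator_def)
  also have "\<dots> = (\<Sum>R\<in>#F. emeasure \<mu> R)"
    using setsF by (intro nn_integral_overlap) auto
  also have "\<dots> \<le> carleson \<mu> \<E> * emeasure \<mu> (shadow F)"
    using sub setsF by (rule sum_emeasure_le_carleson)
  also have "\<dots> \<le> carleson \<mu> \<E> * (M * emeasure \<mu> B)"
    using shadow_le by (rule mult_left_mono) simp
  also have "\<dots> = M * carleson \<mu> \<E> * emeasure \<mu> B"
    by (simp add: ac_simps)
  also have "\<dots> < T * emeasure \<mu> B"
    using T pos fin by (intro ennreal_mult_strict_right_mono) (auto simp: zero_less_iff_neq_zero)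
  finally show False by simp
qed

text \<open>Averaging over the classes: if each shadow covered more than the fraction \<theta> of
  \<open>R\<close>, the integral over \<open>R\<close> of the number of class shadows would be too
  large for an overlap that exceeds \<open>T\<close> only on a small part of
  \<open>R\<close>.\<close>

lemma exists_class_of_small_intersection:
  fixes \<eta> \<theta> T :: real
  assumes sets: "\<And>Q S. Q \<in># P \<Longrightarrow> S \<in># Q \<Longrightarrow> S \<in> sets \<mu>"
    and R: "R \<in> sets \<mu>" "emeasure \<mu> R < \<infinity>"
    and num: "0 \<le> T" "0 \<le> \<eta>" "\<eta> < \<theta>" "T < real (size P) * (\<theta> - \<eta>)"
    and small: "emeasure \<mu> ({x \<in> space \<mu>. ennreal T < overlap (\<Sum>\<^sub># P) x} \<inter> R)
      \<le> ennreal \<eta> * emeasure \<mu> R"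
  shows "\<exists>Q\<in>#P. emeasure \<mu> (R \<inter> shadow Q) \<le> ennreal \<theta> * emeasure \<mu> R"
proof (rule ccontr)
  let ?N = "size P"
  define B where "B = {x \<in> space \<mu>. ennreal T < overlap (\<Sum>\<^sub># P) x}"
  assume "\<not> ?thesis"
  then have big: "ennreal \<theta> * emeasure \<mu> R < emeasure \<mu> (R \<inter> shadow Q)" if "Q \<in># P" for Q
    using that by (simp add: not_le)
  \<comment> \<open>Since \<open>0 \<le> T\<close>, the strict bound on \<open>T\<close> rules out
    an empty family of classes. Any one class then shows that \<open>R\<close> is not null.\<close>
  have "size P \<noteq> 0" using num by (intro notI) simp
  then obtain Q where Q: "Q \<in># P" by (metis multiset_nonemptyE size_empty)
  have "emeasure \<mu> (R \<inter> shadow Q) \<le> emeasure \<mu> R"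
    using R by (intro emeasure_mono) auto
  then have pos: "emeasure \<mu> R \<noteq> 0" using big[OF Q] by auto
  have "overlap (\<Sum>\<^sub># P) \<in> borel_measurable \<mu>"
    using sets by (intro borel_measurable_overlap) auto
  then have B: "B \<in> sets \<mu>" unfolding B_def by measurable
  have "of_nat ?N * (ennreal \<theta> * emeasure \<mu> R) = (\<Sum>Q\<in>#P. ennreal \<theta> * emeasure \<mu> R)"
    by simp
  also have "\<dots> \<le> (\<Sum>Q\<in>#P. emeasure \<mu> (R \<inter> shadow Q))"
    using big by (intro sum_mset_mono less_imp_le)
  also have "\<dots> = (\<integral>\<^sup>+x\<in>R. overlap (image_mset shadow P) x \<partial>\<mu>)"
    using R sets by (subst set_nn_integral_overlap) (auto intro: sets_shadow simp: image_mset.compositionality o_def)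
  \<comment> \<open>Off \<open>B\<close> the total overlap, hence the number of shadows, is at most
    \<open>T\<close>; on \<open>B\<close> only the trivial bound by the number of classes is
    available.\<close>
  also have "\<dots> \<le> (\<integral>\<^sup>+x. ennreal T * indicator R x + of_nat ?N * indicator (B \<inter> R) x \<partial>\<mu>)"
  proof (rule nn_integral_mono)
    fix x assume x: "x \<in> space \<mu>"
    show "overlap (image_mset shadow P) x * indicator R x
      \<le> ennreal T * indicator R x + of_nat ?N * indicator (B \<inter> R) x"
    proof (cases "x \<in> R")
      case True
      show ?thesis
      proof (cases "x \<in> B")
        case inB: True
        have "overlap (image_mset shadow P) x \<le> 0 + of_nat ?N"
          using overlap_le_size[of "image_mset shadow P" x] by simp
        also have "\<dots> \<le> ennreal T + of_nat ?N" by (intro add_right_mono) simp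
        finally show ?thesis using True inB by simp
      next
        case False
        then have "overlap (\<Sum>\<^sub># P) x \<le> ennreal T" using x by (auto simp: B_def)
        then show ?thesis
          using True False overlap_shadows_le[of P x] by simp
      qed
    qed simp
  qed
  also have "\<dots> = ennreal T * emeasure \<mu> R + of_nat ?N * emeasure \<mu> (B \<inter> R)"
    using R B by (subst nn_integral_add) (auto simp: nn_integral_cmult_indicator)
  also have "\<dots> \<le> ennreal T * emeasure \<mu> R + of_nat ?N * (ennreal \<eta> * emeasure \<mu> R)"
    using small unfolding B_def by (intro add_left_mono mult_left_mono) auto
  finally have le: "of_nat ?N * (ennreal \<theta> * emeasure \<mu> R)
    \<le> ennreal T * emeasure \<mu> R + of_nat ?N * (ennreal \<eta> * emeasure \<mu> R)" .
  \<comment> \<open>With \<open>r\<close> finite and positive, dividing by it in the reals leaves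
    \<open>N * (\<theta> - \<eta>) \<le> T\<close>, where \<open>N\<close> is the number of classes,
    against the choice of \<open>T\<close>.\<close>
  obtain r where r: "0 \<le> r" "emeasure \<mu> R = ennreal r"
    using R(2) by (cases "emeasure \<mu> R") auto
  with pos have "0 < r" by (cases "r = 0") auto
  have "real ?N * (\<theta> * r) \<le> T * r + real ?N * (\<eta> * r)"
    using le r num
    by (simp add: ennreal_of_nat_eq_real_of_nat flip: ennreal_mult ennreal_plus)
  then have "(real ?N * (\<theta> - \<eta>)) * r \<le> T * r" by (simp add: algebra_simps)
  then show False using \<open>0 < r\<close> num by (simp add: mult_le_cancel_right)
qed

section \<open>Greedy insertion and the Carleson bound of a class\<close>

text \<open>The part of \<open>R\<close> outside the shadow of \<open>Q\<close> has at least the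
  fraction \<open>1 - \<theta>\<close> of its measure and pays for \<open>R\<close>. A sub-multiset
  of \<open>Q\<close> covers even less of \<open>R\<close>, so the bound passes to all sub-multisets
  at once.\<close>

lemma carleson_bound_add_mset:
  fixes \<theta> :: real
  assumes sets: "\<And>S. S \<in># Q \<Longrightarrow> S \<in> sets \<mu>" and R: "R \<in> sets \<mu>" "emeasure \<mu> R < \<infinity>"
    and num: "0 \<le> \<theta>" "\<theta> < 1"
    and small: "emeasure \<mu> (R \<inter> shadow Q) \<le> ennreal \<theta> * emeasure \<mu> R"
    and Q: "\<And>G. G \<subseteq># Q \<Longrightarrow>
      (\<Sum>S\<in>#G. emeasure \<mu> S) \<le> ennreal (1 / (1 - \<theta>)) * emeasure \<mu> (shadow G)"
    and G: "G \<subseteq># add_mset R Q"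
  shows "(\<Sum>S\<in>#G. emeasure \<mu> S) \<le> ennreal (1 / (1 - \<theta>)) * emeasure \<mu> (shadow G)"
proof (cases "R \<in># G")
  case False
  then have "G \<subseteq># Q" using G
    by (metis subset_eq_diff_conv diff_single_trivial add_mset_add_single)
  then show ?thesis by (rule Q)
next
  case True
  let ?K = "ennreal (1 / (1 - \<theta>))"
  obtain G' where G': "G = add_mset R G'" using True by (metis mset_add)
  with G have sub: "G' \<subseteq># Q" by simp
  have mG': "shadow G' \<in> sets \<mu>"
    using sub sets by (intro sets_shadow) (auto dest: mset_subset_eqD)
  have mQ: "shadow Q \<in> sets \<mu>" using sets by (rule sets_shadow)
  have split: "emeasure \<mu> R = emeasure \<mu> (R \<inter> shadow Q) + emeasure \<mu> (R - shadow Q)"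
    using R mQ by (subst plus_emeasure) (auto intro!: arg_cong[where f = "emeasure \<mu>"])
  have "emeasure \<mu> (R - shadow Q) \<le> emeasure \<mu> R" using R by (intro emeasure_mono) auto
  then obtain a b r where abr: "0 \<le> a" "0 \<le> b" "0 \<le> r" "emeasure \<mu> (R \<inter> shadow Q) = ennreal a"
      "emeasure \<mu> (R - shadow Q) = ennreal b" "emeasure \<mu> R = ennreal r"
    using R(2) split
    by (cases "emeasure \<mu> R"; cases "emeasure \<mu> (R \<inter> shadow Q)";
        cases "emeasure \<mu> (R - shadow Q)") (auto simp: top_unique)
  have "a \<le> \<theta> * r" using small abr num by (simp flip: ennreal_mult)
  moreover have "r = a + b" using split abr by (simp flip: ennreal_plus)
  \<comment> \<open>From \<open>a \<le> \<theta> * r\<close> and \<open>r = a + b\<close> one gets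
    \<open>(1 - \<theta>) * r \<le> b\<close>.\<close>
  ultimately have "r \<le> 1 / (1 - \<theta>) * b" using num by (simp add: field_simps)
  then have "emeasure \<mu> R \<le> ?K * emeasure \<mu> (R - shadow Q)"
    using abr num by (simp flip: ennreal_mult)
  also have "\<dots> \<le> ?K * emeasure \<mu> (R - shadow G')"
    using R mG' shadow_mono[OF sub] by (intro mult_left_mono emeasure_mono) auto
  finally have "(\<Sum>S\<in>#G. emeasure \<mu> S)
      \<le> ?K * emeasure \<mu> (R - shadow G') + ?K * emeasure \<mu> (shadow G')"
    using Q[OF sub] by (simp add: G' add_mono)
  also have "\<dots> = ?K * (emeasure \<mu> (R - shadow G') + emeasure \<mu> (shadow G'))"
    by (simp add: distrib_left)
  also have "emeasure \<mu> (R - shadow G') + emeasure \<mu> (shadow G') = emeasure \<mu> (shadow G)"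
    using R mG' by (subst plus_emeasure) (auto simp: G' intro!: arg_cong[where f = "emeasure \<mu>"])
  finally show ?thesis .
qed

text \<open>Induction on sub-multisets \<open>F\<close> of \<E>: a selected \<open>R\<close> is
  removed, the rest is distributed, and \<open>R\<close> is inserted last. The weak-type hypothesis
  always refers to the maximal operator of \<E>, so it remains available for every
  \<open>F\<close>.\<close>

lemma greedy_partition:
  fixes \<eta> \<theta> T :: real
  assumes sets: "\<And>R. R \<in># \<E> \<Longrightarrow> R \<in> sets \<mu> \<and> emeasure \<mu> R < \<infinity>"
    and weak: "\<And>E. E \<in> sets \<mu> \<Longrightarrow>
      emeasure \<mu> {x \<in> space \<mu>. maximal_op \<mu> \<E> (indicator E) x > ennreal \<eta>} \<le> M * emeasure \<mu> E"
    and num: "0 \<le> T" "0 \<le> \<eta>" "\<eta> < \<theta>" "\<theta> < 1" "T < real N * (\<theta> - \<eta>)"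
    and T: "M * carleson \<mu> \<E> < ennreal T"
  shows "\<exists>P. size P = N \<and> \<Sum>\<^sub># P = \<E> \<and> (\<forall>Q. Q \<in># P \<longrightarrow> carleson \<mu> Q \<le> ennreal (1 / (1 - \<theta>)))"
proof -
  let ?K = "ennreal (1 / (1 - \<theta>))"
  \<comment> \<open>The claim keeps the inequality for all \<open>G\<close>, the form that can be
    propagated by \<open>carleson_bound_add_mset\<close>. Empty classes are allowed, so their number
    stays exactly \<open>N\<close>.\<close>
  have "\<exists>P. size P = N \<and> \<Sum>\<^sub># P = F \<and> (\<forall>Q G. Q \<in># P \<longrightarrow> G \<subseteq># Q \<longrightarrow>
      (\<Sum>S\<in>#G. emeasure \<mu> S) \<le> ?K * emeasure \<mu> (shadow G))"
    if "F \<subseteq># \<E>" for F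
    using that
  proof (induction "size F" arbitrary: F)
    case 0
    then show ?case
      by (intro exI[of _ "replicate_mset N {#}"]) (auto simp: in_replicate_mset)
  next
    case (Suc n)
    then have "F \<noteq> {#}" by auto
    then have "\<exists>R\<in>#F. emeasure \<mu> ({x \<in> space \<mu>. ennreal T < overlap F x} \<inter> R)
        \<le> ennreal \<eta> * emeasure \<mu> R"
      by (intro exists_set_of_small_overlap[OF sets weak Suc.prems _ T])
    then obtain R where R: "R \<in># F"
      and light: "emeasure \<mu> ({x \<in> space \<mu>. ennreal T < overlap F x} \<inter> R) \<le> ennreal \<eta> * emeasure \<mu> R"
      by (elim bexE)
    obtain F' where F': "F = add_mset R F'" using R by (metis mset_add)
    have "F' \<subseteq># F" by (simp add: F')
    then have sub: "F' \<subseteq># \<E>" using Suc.prems by (rule subset_mset.order_trans)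
    have RE: "R \<in> sets \<mu>" "emeasure \<mu> R < \<infinity>"
      using sets mset_subset_eqD[OF Suc.prems R] by auto
    have "n = size F'" using Suc.hyps F' by simp
    from Suc.hyps(1)[OF this sub] obtain P where P: "size P = N" "\<Sum>\<^sub># P = F'"
      and bound: "\<And>Q G. Q \<in># P \<Longrightarrow> G \<subseteq># Q \<Longrightarrow>
        (\<Sum>S\<in>#G. emeasure \<mu> S) \<le> ?K * emeasure \<mu> (shadow G)"
      by auto
    have setsP: "S \<in> sets \<mu>" if "Q \<in># P" "S \<in># Q" for Q S
    proof -
      have "S \<in># F'" using that P(2) by auto
      then show ?thesis using sets[OF mset_subset_eqD[OF sub]] by simp
    qed
    have mF: "overlap F \<in> borel_measurable \<mu>"
      using sets[OF mset_subset_eqD[OF Suc.prems]] by (intro borel_measurable_overlap) simp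
    \<comment> \<open>\<open>R\<close> was selected against the overlap of \<open>F\<close>, whereas
      the classes built so far contain only \<open>F'\<close>; the smaller overlap shrinks the
      exceptional set.\<close>
    have "emeasure \<mu> ({x \<in> space \<mu>. ennreal T < overlap F' x} \<inter> R)
        \<le> emeasure \<mu> ({x \<in> space \<mu>. ennreal T < overlap F x} \<inter> R)"
    proof (rule emeasure_mono)
      have "overlap F' x \<le> overlap F x" for x by (simp add: F' add_increasing)
      then show "{x \<in> space \<mu>. ennreal T < overlap F' x} \<inter> R
          \<subseteq> {x \<in> space \<mu>. ennreal T < overlap F x} \<inter> R"
        by (auto intro: less_le_trans)
      show "{x \<in> space \<mu>. ennreal T < overlap F x} \<inter> R \<in> sets \<mu>"
        using RE mF by (intro sets.Int) (auto intro: borel_measurable_less)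
    qed
    also note light
    finally have light': "emeasure \<mu> ({x \<in> space \<mu>. ennreal T < overlap (\<Sum>\<^sub># P) x} \<inter> R)
        \<le> ennreal \<eta> * emeasure \<mu> R" by (simp add: P)
    have "T < real (size P) * (\<theta> - \<eta>)" using num(5) P(1) by simp
    then have "\<exists>Q\<in>#P. emeasure \<mu> (R \<inter> shadow Q) \<le> ennreal \<theta> * emeasure \<mu> R"
      by (intro exists_class_of_small_intersection[OF setsP RE num(1-3) _ light'])
    then obtain Q where Q: "Q \<in># P" "emeasure \<mu> (R \<inter> shadow Q) \<le> ennreal \<theta> * emeasure \<mu> R"
      by (elim bexE)
    obtain P' where P': "P = add_mset Q P'" using Q(1) by (metis mset_add)
    have "0 \<le> \<theta>" using num by simp
    show ?case
    proof (intro exI[of _ "add_mset (add_mset R Q) P'"] conjI allI impI)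
      show "size (add_mset (add_mset R Q) P') = N" "\<Sum>\<^sub># (add_mset (add_mset R Q) P') = F"
        using P P' F' by auto
    next
      fix Q' G assume "Q' \<in># add_mset (add_mset R Q) P'" and G: "G \<subseteq># Q'"
      then consider "Q' = add_mset R Q" | "Q' \<in># P'" by auto
      then show "(\<Sum>S\<in>#G. emeasure \<mu> S) \<le> ?K * emeasure \<mu> (shadow G)"
      proof cases
        case 1
        show ?thesis
          by (rule carleson_bound_add_mset[OF setsP[OF Q(1)] RE \<open>0 \<le> \<theta>\<close> num(4) Q(2) bound[OF Q(1)]])
            (use G 1 in simp_all)
      next
        case 2
        then show ?thesis using bound[of Q' G] G by (simp add: P')
      qed
    qed
  qed
  then obtain P where "size P = N" "\<Sum>\<^sub># P = \<E>" and
    "\<And>Q G. Q \<in># P \<Longrightarrow> G \<subseteq># Q \<Longrightarrow> (\<Sum>S\<in>#G. emeasure \<mu> S) \<le> ?K * emeasure \<mu> (shadow G)"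
    by blast
  then show ?thesis by (intro exI[of _ P] conjI allI impI carleson_leI)
qed

section \<open>Choice of the constants and conclusion\<close>

theorem theoremA:
  fixes \<eta> :: real
  assumes "0 < \<eta>" and "\<eta> < 1"
  shows "\<forall>M::ennreal. M < \<infinity> \<longrightarrow>
    (\<exists>C::ennreal. C < \<infinity> \<and>
      (\<forall>(d::nat) (\<mu> :: (nat \<Rightarrow> real) measure) (\<E> :: (nat \<Rightarrow> real) set multiset).
        space \<mu> = Rdim d \<longrightarrow>
        (\<forall>R. R \<in># \<E> \<longrightarrow> R \<in> sets \<mu> \<and> emeasure \<mu> R < \<infinity>) \<longrightarrow>
        (\<forall>E \<in> sets \<mu>.
           emeasure \<mu> {x \<in> space \<mu>. maximal_op \<mu> \<E> (indicator E) x > ennreal \<eta>}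
             \<le> M * emeasure \<mu> E) \<longrightarrow>
        (\<exists>P :: (nat \<Rightarrow> real) set multiset multiset.
           \<Sum>\<^sub># P = \<E> \<and>
           of_nat (size P) \<le> C * max 1 (carleson \<mu> \<E>) \<and>
           (\<forall>\<E>\<^sub>i. \<E>\<^sub>i \<in># P \<longrightarrow> carleson \<mu> \<E>\<^sub>i \<le> C))))"
proof (intro allI impI)
  fix M :: ennreal assume "M < \<infinity>"
  then obtain m where m: "0 \<le> m" "M = ennreal m" by (cases M) auto
  \<comment> \<open>With \<open>\<theta> = (1 + \<eta>) / 2\<close> both
    \<open>\<theta> - \<eta>\<close> and \<open>1 - \<theta>\<close> equal
    \<open>(1 - \<eta>) / 2\<close>. The first summand controls the number of classes before
    rounding and also the Carleson bound \<open>2 / (1 - \<eta>)\<close>; the final 1 absorbs the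
    rounding.\<close>
  define C where "C = (m + 1) * 2 / (1 - \<eta>) + 1"
  have K: "1 / (1 - (1 + \<eta>) / 2) = 2 / (1 - \<eta>)"
    using assms by (simp add: field_simps)
  have "2 / (1 - \<eta>) \<le> (m + 1) * 2 / (1 - \<eta>)"
    using assms m by (intro divide_right_mono) auto
  then have KC: "2 / (1 - \<eta>) \<le> C" by (simp add: C_def)
  show "\<exists>C::ennreal. C < \<infinity> \<and>
      (\<forall>(d::nat) (\<mu> :: (nat \<Rightarrow> real) measure) (\<E> :: (nat \<Rightarrow> real) set multiset).
        space \<mu> = Rdim d \<longrightarrow>
        (\<forall>R. R \<in># \<E> \<longrightarrow> R \<in> sets \<mu> \<and> emeasure \<mu> R < \<infinity>) \<longrightarrow>
        (\<forall>E \<in> sets \<mu>.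
           emeasure \<mu> {x \<in> space \<mu>. maximal_op \<mu> \<E> (indicator E) x > ennreal \<eta>}
             \<le> M * emeasure \<mu> E) \<longrightarrow>
        (\<exists>P :: (nat \<Rightarrow> real) set multiset multiset.
           \<Sum>\<^sub># P = \<E> \<and>
           of_nat (size P) \<le> C * max 1 (carleson \<mu> \<E>) \<and>
           (\<forall>\<E>\<^sub>i. \<E>\<^sub>i \<in># P \<longrightarrow> carleson \<mu> \<E>\<^sub>i \<le> C)))"
  proof (intro exI[of _ "ennreal C"] conjI allI impI)
    show "ennreal C < \<infinity>" by simp
  next
    fix d :: nat and \<mu> :: "(nat \<Rightarrow> real) measure" and \<E> :: "(nat \<Rightarrow> real) set multiset"
    assume sets: "\<forall>R. R \<in># \<E> \<longrightarrow> R \<in> sets \<mu> \<and> emeasure \<mu> R < \<infinity>"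
      and weak: "\<forall>E \<in> sets \<mu>.
           emeasure \<mu> {x \<in> space \<mu>. maximal_op \<mu> \<E> (indicator E) x > ennreal \<eta>}
             \<le> M * emeasure \<mu> E"
    have "carleson \<mu> \<E> < \<infinity>" using sets by (intro carleson_finite) auto
    then obtain l where l: "0 \<le> l" "carleson \<mu> \<E> = ennreal l"
      by (cases "carleson \<mu> \<E>") auto
    \<comment> \<open>Adding 1 makes \<open>T\<close> strictly larger than \<open>m * l\<close>,
      even if that product is 0.\<close>
    define T where "T = m * l + 1"
    define s where "s = T * 2 / (1 - \<eta>)"
    \<comment> \<open>Floor plus one, rather than ceiling, gives \<open>s < N\<close> strictly also
      for integral \<open>s\<close>.\<close>
    define N where "N = nat \<lfloor>s\<rfloor> + 1"
    have "0 \<le> T" using m l by (simp add: T_def)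
    then have "0 \<le> s" using assms by (simp add: s_def)
    then have N: "s < real N" "real N \<le> s + 1" by (auto simp: N_def) linarith+
    have "T = s * ((1 + \<eta>) / 2 - \<eta>)" using assms by (simp add: s_def field_simps)
    also have "\<dots> < real N * ((1 + \<eta>) / 2 - \<eta>)"
      using N assms by (intro mult_strict_right_mono) auto
    finally have TN: "T < real N * ((1 + \<eta>) / 2 - \<eta>)" .
    have T: "M * carleson \<mu> \<E> < ennreal T"
      using m l by (simp add: T_def ennreal_less_iff flip: ennreal_mult)
    obtain P where P: "size P = N" "\<Sum>\<^sub># P = \<E>"
      and bound: "\<And>Q. Q \<in># P \<Longrightarrow> carleson \<mu> Q \<le> ennreal (2 / (1 - \<eta>))"
      using greedy_partition[of \<E> \<mu> \<eta> M T "(1 + \<eta>) / 2" N] sets weak \<open>0 \<le> T\<close> assms TN T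
      unfolding K by auto
    have "T \<le> (m + 1) * max 1 l"
    proof -
      have "m * l \<le> m * max 1 l" using m by (intro mult_left_mono) auto
      then show ?thesis by (simp add: T_def distrib_right add_mono)
    qed
    then have "s \<le> (m + 1) * max 1 l * 2 / (1 - \<eta>)"
      using assms unfolding s_def by (intro divide_right_mono mult_right_mono) auto
    \<comment> \<open>The rounding error 1 is at most \<open>max 1 l\<close>, so it fits the product
      form of the bound.\<close>
    then have "real N \<le> (m + 1) * max 1 l * 2 / (1 - \<eta>) + max 1 l"
      using N by simp
    also have "\<dots> = C * max 1 l" by (simp add: C_def algebra_simps)
    finally have "ennreal (real N) \<le> ennreal (C * max 1 l)" by (rule ennreal_leI)
    also have "\<dots> = ennreal C * max 1 (carleson \<mu> \<E>)"
      using l by (simp add: ennreal_mult'' max_def ennreal_le_1 flip: ennreal_1)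
    finally have size: "of_nat (size P) \<le> ennreal C * max 1 (carleson \<mu> \<E>)"
      by (simp add: P ennreal_of_nat_eq_real_of_nat)
    show "\<exists>P. \<Sum>\<^sub># P = \<E> \<and> of_nat (size P) \<le> ennreal C * max 1 (carleson \<mu> \<E>) \<and>
        (\<forall>\<E>\<^sub>i. \<E>\<^sub>i \<in># P \<longrightarrow> carleson \<mu> \<E>\<^sub>i \<le> ennreal C)"
      using P size bound ennreal_leI[OF KC] order_trans by blast
  qed
qed

end
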